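(* Let $R$ be a ring and let $\alpha,\gamma\in\operatorname{Aut}(R)$ be such that $\gamma^2=\mathrm{id}_R$. Let $S=R[x^{\pm1};\alpha]$. There exists $\theta\in\operatorname{Aut}(S)$ such that $\theta|_R=\gamma$ and $\theta(x)=x^{-1}$ if and only if $\alpha$ is $\gamma$-reversible.
   Context: Rings are associative with $1$, not necessarily commutative, and $\operatorname{Aut}(R)$ denotes the group of ring automorphisms of $R$. $R[x^{\pm1};\alpha]$ denotes the skew Laurent polynomial ring: it is free as a left $R$-module on $\{x^i : i\in\mathbb{Z}\}$ with multiplication determined by $xr=\alpha(r)x$ for all $r\in R$. For $\alpha,\gamma\in\operatorname{Aut}(R)$ with $\gamma^2=\mathrm{id}_R$, $\alpha$ is called $\gamma$-reversible if $\gamma\alpha\gamma^{-1}=\alpha^{-1}$. *)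

theory Defs
  imports "HOL-Algebra.Algebra"
begin

text \<open>Ring automorphisms of \<open>R\<close> are the elements of \<open>ring_iso R R\<close>. As usual in HOL-Algebra
  these are functions on the whole type whose values outside the carrier are irrelevant; hence
  inverses are taken relative to the carrier, and identities between automorphisms are asserted
  on the carrier only.\<close>

definition aut_pow :: "('a, 'm) ring_scheme \<Rightarrow> ('a \<Rightarrow> 'a) \<Rightarrow> int \<Rightarrow> 'a \<Rightarrow> 'a" where
  "aut_pow R \<alpha> i =
    (if 0 \<le> i then \<alpha> ^^ nat i else (inv_into (carrier R) \<alpha>) ^^ nat (- i))"

text \<open>A finitely supported \<open>f :: int \<Rightarrow> 'a\<close> stands for \<open>\<Sum>i. f i x\<^sup>i\<close>, with coefficients on the
  left. Since \<open>x r = \<alpha>(r) x\<close> gives \<open>x\<^sup>i r = \<alpha>\<^sup>i(r) x\<^sup>i\<close> for all integers \<open>i\<close>, the coefficient of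
  \<open>x\<^sup>n\<close> in \<open>f g\<close> is the sum of \<open>f i \<alpha>\<^sup>i(g (n - i))\<close> over \<open>i\<close>. The sum is restricted
  to the support of \<open>f\<close>, as \<open>finsum\<close> is only meaningful over finite sets.\<close>

definition skew_laurent :: "('a, 'm) ring_scheme \<Rightarrow> ('a \<Rightarrow> 'a) \<Rightarrow> (int \<Rightarrow> 'a) ring" where
  "skew_laurent R \<alpha> =
    \<lparr>carrier = {f. (\<forall>i. f i \<in> carrier R) \<and> finite {i. f i \<noteq> \<zero>\<^bsub>R\<^esub>}},
     monoid.mult = (\<lambda>f g n. \<Oplus>\<^bsub>R\<^esub>i\<in>{i. f i \<noteq> \<zero>\<^bsub>R\<^esub>}. f i \<otimes>\<^bsub>R\<^esub> aut_pow R \<alpha> i (g (n - i))),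
     monoid.one = (\<lambda>n. if n = 0 then \<one>\<^bsub>R\<^esub> else \<zero>\<^bsub>R\<^esub>),
     ring.zero = (\<lambda>n. \<zero>\<^bsub>R\<^esub>),
     ring.add = (\<lambda>f g n. f n \<oplus>\<^bsub>R\<^esub> g n)\<rparr>"

definition sl_monom :: "('a, 'm) ring_scheme \<Rightarrow> 'a \<Rightarrow> int \<Rightarrow> int \<Rightarrow> 'a" where
  "sl_monom R r i = (\<lambda>n. if n = i then r else \<zero>\<^bsub>R\<^esub>)"

definition sl_const :: "('a, 'm) ring_scheme \<Rightarrow> 'a \<Rightarrow> int \<Rightarrow> 'a" where
  "sl_const R r = sl_monom R r 0"

definition sl_X :: "('a, 'm) ring_scheme \<Rightarrow> int \<Rightarrow> 'a" where
  "sl_X R = sl_monom R \<one>\<^bsub>R\<^esub> 1"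

definition reversible :: "('a, 'm) ring_scheme \<Rightarrow> ('a \<Rightarrow> 'a) \<Rightarrow> ('a \<Rightarrow> 'a) \<Rightarrow> bool" where
  "reversible R \<gamma> \<alpha> \<longleftrightarrow>
    (\<forall>r\<in>carrier R. \<gamma> (\<alpha> (inv_into (carrier R) \<gamma> r)) = inv_into (carrier R) \<alpha> r)"

lemma ring_iso_inv_into_closed:
  assumes "\<alpha> \<in> ring_iso R R" "r \<in> carrier R"
  shows "inv_into (carrier R) \<alpha> r \<in> carrier R"
  using assms by (auto simp: ring_iso_def bij_betw_def intro: inv_into_into)

lemma aut_pow_closed:
  assumes "\<alpha> \<in> ring_iso R R" "r \<in> carrier R"
  shows "aut_pow R \<alpha> i r \<in> carrier R"
proof -
  have "(\<alpha> ^^ k) r \<in> carrier R" for k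
    by (induction k) (use assms in \<open>auto simp: ring_iso_def ring_hom_def\<close>)
  moreover have "(inv_into (carrier R) \<alpha> ^^ k) r \<in> carrier R" for k
    by (induction k) (use assms ring_iso_inv_into_closed in auto)
  ultimately show ?thesis by (simp add: aut_pow_def)
qed

lemma aut_pow_zero:
  assumes "ring R" "\<alpha> \<in> ring_iso R R"
  shows "aut_pow R \<alpha> i \<zero>\<^bsub>R\<^esub> = \<zero>\<^bsub>R\<^esub>"
proof -
  interpret ring R by fact
  have z: "\<alpha> \<zero>\<^bsub>R\<^esub> = \<zero>\<^bsub>R\<^esub>"
    using assms by (intro ring_hom_zero) (auto simp: ring_iso_def)
  have iz: "inv_into (carrier R) \<alpha> \<zero>\<^bsub>R\<^esub> = \<zero>\<^bsub>R\<^esub>"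
    using assms(2) z by (metis (no_types, lifting) bij_betw_def inv_into_f_f mem_Collect_eq ring_iso_def zero_closed)
  have "(\<alpha> ^^ k) \<zero>\<^bsub>R\<^esub> = \<zero>\<^bsub>R\<^esub>" for k by (induction k) (simp_all add: z)
  moreover have "(inv_into (carrier R) \<alpha> ^^ k) \<zero>\<^bsub>R\<^esub> = \<zero>\<^bsub>R\<^esub>" for k
    by (induction k) (simp_all add: iz)
  ultimately show ?thesis by (simp add: aut_pow_def)
qed

lemma sl_monom_mult:
  assumes "ring R" "\<alpha> \<in> ring_iso R R" "a \<in> carrier R" "b \<in> carrier R"
  shows "sl_monom R a i \<otimes>\<^bsub>skew_laurent R \<alpha>\<^esub> sl_monom R b j
       = sl_monom R (a \<otimes>\<^bsub>R\<^esub> aut_pow R \<alpha> i b) (i + j)"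
proof
  interpret ring R by fact
  fix n
  show "(sl_monom R a i \<otimes>\<^bsub>skew_laurent R \<alpha>\<^esub> sl_monom R b j) n
       = sl_monom R (a \<otimes>\<^bsub>R\<^esub> aut_pow R \<alpha> i b) (i + j) n"
  proof (cases "a = \<zero>\<^bsub>R\<^esub>")
    case True
    then show ?thesis
      using assms aut_pow_closed[OF assms(2,4)] by (simp add: skew_laurent_def sl_monom_def)
  next
    case False
    have "{k. sl_monom R a i k \<noteq> \<zero>\<^bsub>R\<^esub>} = {i}"
      using False by (auto simp: sl_monom_def)
    then show ?thesis
      using assms aut_pow_closed[OF assms(2,4)] aut_pow_zero[OF assms(1,2)]
      by (auto simp: skew_laurent_def sl_monom_def)
  qed
qed

corollary sl_X_mult_const:
  assumes "ring R" "\<alpha> \<in> ring_iso R R" "r \<in> carrier R"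
  shows "sl_X R \<otimes>\<^bsub>skew_laurent R \<alpha>\<^esub> sl_const R r
       = sl_const R (\<alpha> r) \<otimes>\<^bsub>skew_laurent R \<alpha>\<^esub> sl_X R"
proof -
  interpret ring R by fact
  have "\<alpha> r \<in> carrier R" using assms by (auto simp: ring_iso_def ring_hom_def)
  then show ?thesis
    using assms by (simp add: sl_X_def sl_const_def sl_monom_mult aut_pow_def)
qed

end

theory Submission
  imports Defs
begin

text \<open>Applying \<open>\<theta>\<close> to \<open>x r = \<alpha>(r) x\<close> gives \<open>x\<^sup>-\<^sup>1 \<gamma>(r) = \<gamma>(\<alpha>(r)) x\<^sup>-\<^sup>1\<close>, whence
  \<open>\<alpha>\<^sup>-\<^sup>1 \<gamma> = \<gamma> \<alpha>\<close>. Conversely, \<open>\<gamma> \<alpha>\<^sup>i = \<alpha>\<^sup>-\<^sup>i \<gamma>\<close> for all integers \<open>i\<close> makes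
  \<open>\<Sum>i. f i x\<^sup>i \<mapsto> \<Sum>i. \<gamma> (f i) x\<^sup>-\<^sup>i\<close> multiplicative, and this map is its own inverse.\<close>

lemma sl_monom_closed:
  assumes "ring R" "a \<in> carrier R"
  shows "sl_monom R a i \<in> carrier (skew_laurent R \<alpha>)"
proof -
  interpret ring R by fact
  have "finite {n. sl_monom R a i n \<noteq> \<zero>\<^bsub>R\<^esub>}"
    by (rule finite_subset[of _ "{i}"]) (auto simp: sl_monom_def)
  then show ?thesis
    using assms by (auto simp: skew_laurent_def sl_monom_def)
qed

text \<open>Left multiplication by \<open>x\<close> shifts coefficients by one and applies \<alpha>,
  so it inherits injectivity from \<alpha>. This cancellation law is what pins down the inverse of
  \<open>x\<close> below.\<close>

lemma sl_X_mult:
  assumes "ring R" "\<alpha> \<in> ring_iso R R" "f \<in> carrier (skew_laurent R \<alpha>)"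
  shows "(sl_X R \<otimes>\<^bsub>skew_laurent R \<alpha>\<^esub> f) n = \<alpha> (f (n - 1))"
proof -
  interpret ring R by fact
  have c: "\<alpha> (f m) \<in> carrier R" for m
    using assms(2,3) by (auto simp: skew_laurent_def ring_iso_def ring_hom_def)
  show ?thesis
  proof (cases "\<one>\<^bsub>R\<^esub> = \<zero>\<^bsub>R\<^esub>")
    \<comment> \<open>In the zero ring \<open>sl_X R\<close> has empty support, so the sum defining
      the product is empty and the support is not \<open>{1}\<close>.\<close>
    case True
    then have "carrier R = {\<zero>\<^bsub>R\<^esub>}" by (rule one_zeroD)
    then show ?thesis
      using True c[of "n - 1"] by (simp add: skew_laurent_def sl_X_def sl_monom_def)
  next
    case False
    have "{k. sl_X R k \<noteq> \<zero>\<^bsub>R\<^esub>} = {1}"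
      using False by (auto simp: sl_X_def sl_monom_def)
    then show ?thesis
      using c by (simp add: skew_laurent_def sl_X_def sl_monom_def aut_pow_def)
  qed
qed

text \<open>The inverse is a definite description, so uniqueness has to be proved along with
  existence. The usual argument uses associativity in \<open>skew_laurent R \<alpha>\<close>; here
  cancellation of \<open>x\<close> on the left replaces it.\<close>

lemma inv_sl_X:
  assumes "ring R" "\<alpha> \<in> ring_iso R R"
  shows "inv\<^bsub>skew_laurent R \<alpha>\<^esub> (sl_X R) = sl_monom R \<one>\<^bsub>R\<^esub> (- 1)"
proof -
  interpret ring R by fact
  let ?S = "skew_laurent R \<alpha>"
  let ?Y = "sl_monom R \<one>\<^bsub>R\<^esub> (- 1)"
  have one: "\<one>\<^bsub>?S\<^esub> = sl_monom R \<one>\<^bsub>R\<^esub> 0"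
    by (simp add: skew_laurent_def sl_monom_def)
  have a1: "\<alpha> \<one>\<^bsub>R\<^esub> = \<one>\<^bsub>R\<^esub>" and inj: "inj_on \<alpha> (carrier R)"
    using assms(2) by (auto simp: ring_iso_def ring_hom_def bij_betw_def)
  have ia1: "inv_into (carrier R) \<alpha> \<one>\<^bsub>R\<^esub> = \<one>\<^bsub>R\<^esub>"
    using inv_into_f_f[OF inj one_closed] a1 by simp
  have XY: "sl_X R \<otimes>\<^bsub>?S\<^esub> ?Y = \<one>\<^bsub>?S\<^esub>"
    using assms by (simp add: one sl_X_def sl_monom_mult aut_pow_def a1)
  have YX: "?Y \<otimes>\<^bsub>?S\<^esub> sl_X R = \<one>\<^bsub>?S\<^esub>"
    using assms by (simp add: one sl_X_def sl_monom_mult aut_pow_def ia1)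
  have uniq: "f = ?Y" if f: "f \<in> carrier ?S" and Xf: "sl_X R \<otimes>\<^bsub>?S\<^esub> f = \<one>\<^bsub>?S\<^esub>" for f
  proof
    fix n
    \<comment> \<open>Both \<open>x f\<close> and \<open>x ?Y\<close> equal one; their coefficients
      at \<open>n + 1\<close> come from \<open>f n\<close> and \<open>?Y n\<close>.\<close>
    have "\<alpha> (f n) = \<alpha> (?Y n)"
      using sl_X_mult[OF assms f, of "n + 1"] sl_X_mult[OF assms sl_monom_closed, of "\<one>\<^bsub>R\<^esub>" "- 1" "n + 1"]
        Xf XY assms(1) by simp
    moreover have "f n \<in> carrier R" "?Y n \<in> carrier R"
      using f by (auto simp: skew_laurent_def sl_monom_def)
    ultimately show "f n = ?Y n"
      using inj by (simp add: inj_on_eq_iff)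
  qed
  show ?thesis
    unfolding m_inv_def
    using XY YX uniq sl_monom_closed[OF assms(1) one_closed] by (intro the_equality) auto
qed

text \<open>Iterating \<open>swap\<close> settles nonnegative exponents; negative ones need the
  mirrored relation \<open>swap'\<close>.\<close>

lemma aut_pow_intertwine:
  assumes \<alpha>: "\<alpha> \<in> ring_iso R R" and \<gamma>: "\<gamma> \<in> ring_iso R R"
    and swap: "\<And>r. r \<in> carrier R \<Longrightarrow> \<gamma> (\<alpha> r) = inv_into (carrier R) \<alpha> (\<gamma> r)"
    and r: "r \<in> carrier R"
  shows "\<gamma> (aut_pow R \<alpha> i r) = aut_pow R \<alpha> (- i) (\<gamma> r)"
proof -
  let ?\<beta> = "inv_into (carrier R) \<alpha>"
  have bij: "bij_betw \<alpha> (carrier R) (carrier R)" and \<gamma>c: "\<And>s. s \<in> carrier R \<Longrightarrow> \<gamma> s \<in> carrier R"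
    using \<alpha> \<gamma> by (auto simp: ring_iso_def ring_hom_def)
  \<comment> \<open>Apply \<open>swap\<close> to \<open>?\<beta> s\<close>, cancel \<alpha> against
    its inverse, and then apply \<alpha> to both sides.\<close>
  have swap': "\<gamma> (?\<beta> s) = \<alpha> (\<gamma> s)" if s: "s \<in> carrier R" for s
  proof -
    have "?\<beta> s \<in> carrier R" using ring_iso_inv_into_closed[OF \<alpha> s] .
    then have "\<alpha> (\<gamma> (\<alpha> (?\<beta> s))) = \<gamma> (?\<beta> s)"
      using swap bij \<gamma>c by (simp add: bij_betw_inv_into_right)
    then show ?thesis
      using bij s by (simp add: bij_betw_inv_into_right)
  qed
  have ca: "(\<alpha> ^^ k) r \<in> carrier R" for k
    using aut_pow_closed[OF \<alpha> r, of "int k"] by (simp add: aut_pow_def)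
  have cb: "(?\<beta> ^^ k) r \<in> carrier R" for k
    by (induction k) (use r ring_iso_inv_into_closed[OF \<alpha>] in auto)
  have "\<gamma> ((\<alpha> ^^ k) r) = (?\<beta> ^^ k) (\<gamma> r)" for k
    by (induction k) (simp_all add: swap ca)
  moreover have "\<gamma> ((?\<beta> ^^ k) r) = (\<alpha> ^^ k) (\<gamma> r)" for k
    by (induction k) (simp_all add: swap' cb)
  ultimately show ?thesis by (simp add: aut_pow_def)
qed

text \<open>The witness for \<theta>. The formula is forced: a ring homomorphism extending \<gamma>
  with \<open>x\<close> sent to \<open>x^-1\<close> must send \<open>r x^i\<close> to
  \<open>\<gamma>(r) x^-i\<close>.\<close>

definition sl_flip :: "('a \<Rightarrow> 'a) \<Rightarrow> (int \<Rightarrow> 'a) \<Rightarrow> int \<Rightarrow> 'a" where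
  "sl_flip \<gamma> f = (\<lambda>n. \<gamma> (f (- n)))"

lemma sl_flip_monom:
  assumes "\<gamma> \<zero>\<^bsub>R\<^esub> = \<zero>\<^bsub>R\<^esub>"
  shows "sl_flip \<gamma> (sl_monom R r i) = sl_monom R (\<gamma> r) (- i)"
  using assms by (auto simp: sl_flip_def sl_monom_def)

text \<open>Products are sums over the support of the left factor, so the support after flipping is
  needed exactly. Injectivity of \<gamma> ensures that no nonzero coefficient is killed.\<close>

lemma supp_sl_flip:
  assumes "ring R" "\<gamma> \<in> ring_iso R R" "\<And>i. f i \<in> carrier R"
  shows "{i. sl_flip \<gamma> f i \<noteq> \<zero>\<^bsub>R\<^esub>} = uminus ` {i. f i \<noteq> \<zero>\<^bsub>R\<^esub>}"
proof -
  interpret ring R by fact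
  have "\<gamma> \<zero>\<^bsub>R\<^esub> = \<zero>\<^bsub>R\<^esub>" "inj_on \<gamma> (carrier R)"
    using assms ring_hom_zero by (auto simp: ring_iso_def bij_betw_def)
  then have "\<gamma> (f i) = \<zero>\<^bsub>R\<^esub> \<longleftrightarrow> f i = \<zero>\<^bsub>R\<^esub>" for i
    using assms(3) by (metis inj_on_eq_iff zero_closed)
  then show ?thesis
    by (force simp: sl_flip_def image_iff)
qed

lemma sl_flip_closed:
  assumes "ring R" "\<gamma> \<in> ring_iso R R" "f \<in> carrier (skew_laurent R \<alpha>)"
  shows "sl_flip \<gamma> f \<in> carrier (skew_laurent R \<alpha>)"
proof -
  have f: "\<And>i. f i \<in> carrier R" "finite {i. f i \<noteq> \<zero>\<^bsub>R\<^esub>}"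
    using assms(3) by (auto simp: skew_laurent_def)
  have "\<gamma> (f i) \<in> carrier R" for i
    using assms(2) f(1) by (auto simp: ring_iso_def ring_hom_def)
  then show ?thesis
    using supp_sl_flip[OF assms(1,2), of f] f by (simp add: skew_laurent_def) (simp add: sl_flip_def)
qed

lemma sl_flip_mult:
  assumes R: "ring R" and \<alpha>: "\<alpha> \<in> ring_iso R R" and \<gamma>: "\<gamma> \<in> ring_iso R R"
    and swap: "\<And>r. r \<in> carrier R \<Longrightarrow> \<gamma> (\<alpha> r) = inv_into (carrier R) \<alpha> (\<gamma> r)"
    and f: "f \<in> carrier (skew_laurent R \<alpha>)" and g: "g \<in> carrier (skew_laurent R \<alpha>)"
  shows "sl_flip \<gamma> (f \<otimes>\<^bsub>skew_laurent R \<alpha>\<^esub> g)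
       = sl_flip \<gamma> f \<otimes>\<^bsub>skew_laurent R \<alpha>\<^esub> sl_flip \<gamma> g"
proof
  fix n
  interpret ring R by fact
  have hom: "\<gamma> \<in> ring_hom R R" using \<gamma> by (simp add: ring_iso_def)
  interpret \<gamma>: ring_hom_ring R R \<gamma>
    using R hom by (intro ring_hom_ringI2)
  have fc: "f i \<in> carrier R" and gc: "g i \<in> carrier R" for i
    using f g by (auto simp: skew_laurent_def)
  let ?A = "{i. f i \<noteq> \<zero>\<^bsub>R\<^esub>}"
  have pc: "aut_pow R \<alpha> i (g m) \<in> carrier R" "aut_pow R \<alpha> i (\<gamma> (g m)) \<in> carrier R" for i m
    using aut_pow_closed[OF \<alpha>] gc by auto
  have "sl_flip \<gamma> (f \<otimes>\<^bsub>skew_laurent R \<alpha>\<^esub> g) n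
      = \<gamma> (\<Oplus>\<^bsub>R\<^esub>i\<in>?A. f i \<otimes>\<^bsub>R\<^esub> aut_pow R \<alpha> i (g (- n - i)))"
    by (simp add: sl_flip_def skew_laurent_def)
  also have "\<dots> = (\<Oplus>\<^bsub>R\<^esub>i\<in>?A. \<gamma> (f i \<otimes>\<^bsub>R\<^esub> aut_pow R \<alpha> i (g (- n - i))))"
    using fc pc by (subst \<gamma>.hom_finsum) (auto simp: o_def)
  \<comment> \<open>Multiplicativity of \<gamma> splits each term, and the intertwining relation
    turns \<open>\<alpha>^i\<close> into \<open>\<alpha>^-i\<close>. The terms are written as
    functions of \<open>- i\<close> to prepare the change of index.\<close>
  also have "\<dots> = (\<Oplus>\<^bsub>R\<^esub>i\<in>?A. sl_flip \<gamma> f (- i) \<otimes>\<^bsub>R\<^esub> aut_pow R \<alpha> (- i) (sl_flip \<gamma> g (n - - i)))"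
    using fc gc pc aut_pow_intertwine[OF \<alpha> \<gamma> swap]
    by (intro finsum_cong') (auto simp: sl_flip_def)
  \<comment> \<open>Substituting \<open>i\<close> for \<open>- i\<close> moves the index set to
    \<open>uminus\<close> applied to \<open>?A\<close>, which is the support of
    \<open>sl_flip \<gamma> f\<close>.\<close>
  also have "\<dots> = (\<Oplus>\<^bsub>R\<^esub>i\<in>uminus ` ?A. sl_flip \<gamma> f i \<otimes>\<^bsub>R\<^esub> aut_pow R \<alpha> i (sl_flip \<gamma> g (n - i)))"
    using fc pc by (subst finsum_reindex) (auto simp: sl_flip_def)
  also have "\<dots> = (sl_flip \<gamma> f \<otimes>\<^bsub>skew_laurent R \<alpha>\<^esub> sl_flip \<gamma> g) n"
    using supp_sl_flip[OF R \<gamma> fc] by (simp add: skew_laurent_def)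
  finally show "sl_flip \<gamma> (f \<otimes>\<^bsub>skew_laurent R \<alpha>\<^esub> g) n
      = (sl_flip \<gamma> f \<otimes>\<^bsub>skew_laurent R \<alpha>\<^esub> sl_flip \<gamma> g) n" .
qed

text \<open>Addition and the unit are checked coefficientwise, \<open>swap\<close> enters through
  multiplicativity, and \<open>invol\<close> gives bijectivity.\<close>

lemma sl_flip_iso:
  assumes R: "ring R" and \<alpha>: "\<alpha> \<in> ring_iso R R" and \<gamma>: "\<gamma> \<in> ring_iso R R"
    and invol: "\<And>r. r \<in> carrier R \<Longrightarrow> \<gamma> (\<gamma> r) = r"
    and swap: "\<And>r. r \<in> carrier R \<Longrightarrow> \<gamma> (\<alpha> r) = inv_into (carrier R) \<alpha> (\<gamma> r)"
  shows "sl_flip \<gamma> \<in> ring_iso (skew_laurent R \<alpha>) (skew_laurent R \<alpha>)"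
proof -
  let ?S = "skew_laurent R \<alpha>"
  interpret ring R by fact
  have hom: "\<gamma> \<in> ring_hom R R" using \<gamma> by (simp add: ring_iso_def)
  have \<gamma>0: "\<gamma> \<zero>\<^bsub>R\<^esub> = \<zero>\<^bsub>R\<^esub>" using ring_hom_zero[OF hom R R] .
  have one: "sl_flip \<gamma> \<one>\<^bsub>?S\<^esub> = \<one>\<^bsub>?S\<^esub>"
    using \<gamma>0 ring_hom_one[OF hom] by (auto simp: sl_flip_def skew_laurent_def)
  have add: "sl_flip \<gamma> (f \<oplus>\<^bsub>?S\<^esub> g) = sl_flip \<gamma> f \<oplus>\<^bsub>?S\<^esub> sl_flip \<gamma> g"
    if "f \<in> carrier ?S" "g \<in> carrier ?S" for f g
    using that ring_hom_add[OF hom] by (auto simp: sl_flip_def skew_laurent_def)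
  have "sl_flip \<gamma> (sl_flip \<gamma> f) = f" if "f \<in> carrier ?S" for f
    using that invol by (auto simp: sl_flip_def skew_laurent_def)
  then have "bij_betw (sl_flip \<gamma>) (carrier ?S) (carrier ?S)"
    using sl_flip_closed[OF R \<gamma>] by (intro bij_betw_byWitness[where f' = "sl_flip \<gamma>"]) auto
  moreover have "sl_flip \<gamma> \<in> ring_hom ?S ?S"
    using sl_flip_closed[OF R \<gamma>] sl_flip_mult[OF R \<alpha> \<gamma> swap] add one
    by (intro ring_hom_memI) auto
  ultimately show ?thesis by (simp add: ring_iso_def)
qed

theorem proposition2p2:
  fixes R :: "('a, 'm) ring_scheme" and \<alpha> \<gamma> :: "'a \<Rightarrow> 'a"
  assumes "ring R"
    and "\<alpha> \<in> ring_iso R R"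
    and "\<gamma> \<in> ring_iso R R"
    and "\<forall>r\<in>carrier R. \<gamma> (\<gamma> r) = r"
  shows "(\<exists>\<theta>\<in>ring_iso (skew_laurent R \<alpha>) (skew_laurent R \<alpha>).
            (\<forall>r\<in>carrier R. \<theta> (sl_const R r) = sl_const R (\<gamma> r)) \<and>
            \<theta> (sl_X R) = inv\<^bsub>skew_laurent R \<alpha>\<^esub> (sl_X R))
         \<longleftrightarrow> reversible R \<gamma> \<alpha>"
    (is "?ext \<longleftrightarrow> _")
proof -
  let ?S = "skew_laurent R \<alpha>"
  let ?\<beta> = "inv_into (carrier R) \<alpha>"
  interpret ring R by fact
  have \<alpha>c: "\<alpha> r \<in> carrier R" and \<gamma>c: "\<gamma> r \<in> carrier R" if "r \<in> carrier R" for r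
    using that assms(2,3) by (auto simp: ring_iso_def ring_hom_def)
  have hom: "\<gamma> \<in> ring_hom R R" and inj: "inj_on \<gamma> (carrier R)"
    using assms(3) by (auto simp: ring_iso_def bij_betw_def)
  have inv\<gamma>: "inv_into (carrier R) \<gamma> r = \<gamma> r" if "r \<in> carrier R" for r
    using inv_into_f_f[OF inj \<gamma>c[OF that]] assms(4) that by simp
  \<comment> \<open>Since \<gamma> is its own inverse on the carrier, \<open>r\<close> may be
    replaced by \<open>\<gamma> r\<close> in the definition without loss, which yields the form used
    as \<open>swap\<close>.\<close>
  have rev: "reversible R \<gamma> \<alpha> \<longleftrightarrow> (\<forall>r\<in>carrier R. \<gamma> (\<alpha> r) = ?\<beta> (\<gamma> r))"
    unfolding reversible_def using inv\<gamma> \<gamma>c assms(4) by metis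
  show ?thesis
  proof
    assume ?ext
    then obtain \<theta> where \<theta>: "\<theta> \<in> ring_hom ?S ?S"
      and \<theta>R: "\<And>r. r \<in> carrier R \<Longrightarrow> \<theta> (sl_const R r) = sl_const R (\<gamma> r)"
      and \<theta>X: "\<theta> (sl_X R) = sl_monom R \<one>\<^bsub>R\<^esub> (- 1)"
      using inv_sl_X[OF assms(1,2)] by (auto simp: ring_iso_def)
    have "\<gamma> (\<alpha> r) = ?\<beta> (\<gamma> r)" if r: "r \<in> carrier R" for r
    proof -
      have X: "sl_X R \<in> carrier ?S" and C: "\<And>s. s \<in> carrier R \<Longrightarrow> sl_const R s \<in> carrier ?S"
        using sl_monom_closed[OF assms(1)] by (auto simp: sl_X_def sl_const_def)
      \<comment> \<open>The chain evaluates \<theta> at \<open>x r = \<alpha>(r) x\<close> in two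
        ways. Moving \<open>\<gamma> r\<close> to the left past \<open>x^-1\<close> costs one
        application of \<open>?\<beta>\<close>.\<close>
      have "sl_monom R (?\<beta> (\<gamma> r)) (- 1) = \<theta> (sl_X R) \<otimes>\<^bsub>?S\<^esub> \<theta> (sl_const R r)"
        using r \<gamma>c assms(1,2) ring_iso_inv_into_closed[OF assms(2)]
        by (simp add: \<theta>X \<theta>R[unfolded sl_const_def] sl_const_def sl_monom_mult aut_pow_def)
      also have "\<dots> = \<theta> (sl_X R \<otimes>\<^bsub>?S\<^esub> sl_const R r)"
        using ring_hom_mult[OF \<theta> X C[OF r]] by simp
      also have "\<dots> = \<theta> (sl_const R (\<alpha> r)) \<otimes>\<^bsub>?S\<^esub> \<theta> (sl_X R)"
        using ring_hom_mult[OF \<theta> C[OF \<alpha>c[OF r]] X] sl_X_mult_const[OF assms(1,2) r] by simp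
      also have "\<dots> = sl_monom R (\<gamma> (\<alpha> r)) (- 1)"
        using r \<alpha>c \<gamma>c assms(1,2) by (simp add: \<theta>X \<theta>R[unfolded sl_const_def] sl_const_def sl_monom_mult aut_pow_def)
      finally show ?thesis
        by (auto simp: sl_monom_def dest: fun_cong[of _ _ "- 1"])
    qed
    then show "reversible R \<gamma> \<alpha>" by (simp add: rev)
  next
    assume "reversible R \<gamma> \<alpha>"
    then have "sl_flip \<gamma> \<in> ring_iso ?S ?S"
      using assms by (intro sl_flip_iso) (auto simp: rev)
    \<comment> \<open>Fixing zero makes \<open>sl_flip \<gamma>\<close> send monomials to monomials;
      fixing one makes the image of \<open>x\<close> exactly \<open>x^-1\<close>.\<close>
    moreover have "\<gamma> \<zero>\<^bsub>R\<^esub> = \<zero>\<^bsub>R\<^esub>" "\<gamma> \<one>\<^bsub>R\<^esub> = \<one>\<^bsub>R\<^esub>"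
      using ring_hom_zero[OF hom assms(1,1)] ring_hom_one[OF hom] by auto
    ultimately show ?ext
      using inv_sl_X[OF assms(1,2)]
      by (intro bexI[of _ "sl_flip \<gamma>"]) (simp_all add: sl_const_def sl_X_def sl_flip_monom)
  qed
qed

end
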